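(* Let $A$ be a monoid (with absorbing element $0$). (1) The collection of admissible monomorphisms (respectively, admissible epimorphisms) is closed under isomorphisms: given a commutative square in $\mathrm{Proj}(A)$ with horizontal morphisms $f:M\to N$ and $f':M'\to N'$ and vertical morphisms $M\to M'$, $N\to N'$ that are isomorphisms, $f$ is an admissible monomorphism (respectively, epimorphism) if and only if $f'$ is. (2) The collection of admissible monomorphisms (respectively, admissible epimorphisms) is closed under composition. (3) The collection of admissible monomorphisms (respectively, epimorphisms) is stable under base change along admissible epimorphisms (respectively, monomorphisms). That is, given a diagram $K\xrightarrow{f}M\xleftarrow{g}N$ of projective $A$-sets with $f$ an admissible monomorphism and $g$ an admissible epimorphism, the fiber product $K\times_M N$ exists in the category of $A$-sets and is projective; the natural map $K\times_M N\to K$ is an admissible epimorphism and the natural map $K\times_M N\to N$ is an admissible monomorphism.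
   Context: A monoid means a not necessarily commutative monoid with unit $1$ and absorbing element $0$; monoid morphisms preserve products, $0$ and $1$. A (left) $A$-set is a pointed set $(M,* )$ with a monoid morphism $A\to \mathrm{Hom}(M,M)$ into the monoid of pointed self-maps of $M$ (so $0\in A$ acts as the constant map to $*$). Morphisms of $A$-sets are pointed maps $f$ with $f(am)=af(m)$. The zero object $*$ is also written $0$. The kernel of $f:M\to N$ is $f^{-1}( * )$. An $A$-set $P$ is projective if $\mathrm{Hom}(P,M)\to\mathrm{Hom}(P,N)$ is onto whenever $M\to N$ is onto. $\mathrm{Proj}(A)$ is the category of finitely generated projective $A$-sets. A morphism $f:M\to N$ is normal if it is injective on $M-\ker(f)$. A sequence $0\to M\xrightarrow{i}N\xrightarrow{j}K\to 0$ of $A$-sets is an admissible short exact sequence if kernel equals image at each term and $i$ and $j$ are normal. A morphism is an admissible monomorphism (respectively, admissible epimorphism) if it appears as the map $i$ (respectively, $j$) in some admissible short exact sequence all of whose $A$-sets are projective. *)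

theory Defs
  imports Main
begin

text \<open>
  The monoid \<open>A\<close> (with unit and absorbing element, not assumed commutative, and \<open>0 = 1\<close> not
  excluded) is a type \<open>'a\<close> of sort \<open>{monoid_mult, mult_zero}\<close>. Pointed sets have explicit carriers,
  and morphisms are functions of which only the values on the carrier matter; accordingly
  morphisms are compared on carriers only.
\<close>

record ('a, 'm) aset =
  points :: "'m set"
  pt :: 'm
  act :: "'a \<Rightarrow> 'm \<Rightarrow> 'm"

definition is_aset :: "('a::{monoid_mult, mult_zero}, 'm) aset \<Rightarrow> bool" where
  "is_aset M \<longleftrightarrow>
     pt M \<in> points M \<and>
     (\<forall>a. \<forall>m\<in>points M. act M a m \<in> points M) \<and>
     (\<forall>a. act M a (pt M) = pt M) \<and>
     (\<forall>m\<in>points M. act M 1 m = m) \<and>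
     (\<forall>a b. \<forall>m\<in>points M. act M (a * b) m = act M a (act M b m)) \<and>
     (\<forall>m\<in>points M. act M 0 m = pt M)"

definition aset_hom ::
  "('a::{monoid_mult, mult_zero}, 'm) aset \<Rightarrow> ('a, 'n) aset \<Rightarrow> ('m \<Rightarrow> 'n) \<Rightarrow> bool" where
  "aset_hom M N f \<longleftrightarrow>
     is_aset M \<and> is_aset N \<and>
     (\<forall>m\<in>points M. f m \<in> points N) \<and>
     f (pt M) = pt N \<and>
     (\<forall>a. \<forall>m\<in>points M. f (act M a m) = act N a (f m))"

definition aset_iso ::
  "('a::{monoid_mult, mult_zero}, 'm) aset \<Rightarrow> ('a, 'n) aset \<Rightarrow> ('m \<Rightarrow> 'n) \<Rightarrow> bool" where
  "aset_iso M N f \<longleftrightarrow> aset_hom M N f \<and>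
     (\<exists>g. aset_hom N M g \<and> (\<forall>m\<in>points M. g (f m) = m) \<and> (\<forall>n\<in>points N. f (g n) = n))"

definition aset_kernel ::
  "('a, 'm) aset \<Rightarrow> ('a, 'n) aset \<Rightarrow> ('m \<Rightarrow> 'n) \<Rightarrow> 'm set" where
  "aset_kernel M N f = {m \<in> points M. f m = pt N}"

definition normal_hom ::
  "('a::{monoid_mult, mult_zero}, 'm) aset \<Rightarrow> ('a, 'n) aset \<Rightarrow> ('m \<Rightarrow> 'n) \<Rightarrow> bool" where
  "normal_hom M N f \<longleftrightarrow> aset_hom M N f \<and> inj_on f (points M - aset_kernel M N f)"

definition finitely_generated :: "('a::{monoid_mult, mult_zero}, 'm) aset \<Rightarrow> bool" where
  "finitely_generated M \<longleftrightarrow> is_aset M \<and>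
     (\<exists>S. finite S \<and> S \<subseteq> points M \<and>
        points M = insert (pt M) {act M a s |a s. s \<in> S})"

text \<open>
  Types cannot be quantified inside a definition, so the lifting property is required for
  \<open>A\<close>-sets carried by the type \<open>'a \<times> 'm\<close>. This is no restriction: by \<open>projective_lift\<close> below it
  implies lifting along surjections between \<open>A\<close>-sets over arbitrary types.
\<close>

definition projective :: "('a::{monoid_mult, mult_zero}, 'm) aset \<Rightarrow> bool" where
  "projective P \<longleftrightarrow> is_aset P \<and>
     (\<forall>(M :: ('a, 'a \<times> 'm) aset) (N :: ('a, 'a \<times> 'm) aset) g f.
        aset_hom M N g \<and> g ` points M = points N \<and> aset_hom P N f \<longrightarrow>
        (\<exists>h. aset_hom P M h \<and> (\<forall>p\<in>points P. g (h p) = f p)))"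

definition in_Proj :: "('a::{monoid_mult, mult_zero}, 'm) aset \<Rightarrow> bool" where
  "in_Proj P \<longleftrightarrow> finitely_generated P \<and> projective P"

text \<open>
  The three equations are exactness of \<open>0 \<longrightarrow> M \<longrightarrow> N \<longrightarrow> K \<longrightarrow> 0\<close> at \<open>M\<close>, \<open>N\<close> and \<open>K\<close>.
\<close>

definition admissible_ses ::
  "('a::{monoid_mult, mult_zero}, 'm) aset \<Rightarrow> ('a, 'n) aset \<Rightarrow> ('a, 'k) aset \<Rightarrow>
   ('m \<Rightarrow> 'n) \<Rightarrow> ('n \<Rightarrow> 'k) \<Rightarrow> bool" where
  "admissible_ses M N K i j \<longleftrightarrow>
     normal_hom M N i \<and> normal_hom N K j \<and>
     aset_kernel M N i = {pt M} \<and>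
     aset_kernel N K j = i ` points M \<and>
     points K = j ` points N"

text \<open>
  In the next two definitions the existentially quantified outer term is carried by the type of
  the middle term \<open>N\<close>. By \<open>admissible_monoI\<close> and \<open>admissible_epiI\<close> below, an outer term over any
  other type would do as well.
\<close>

definition admissible_mono ::
  "('a::{monoid_mult, mult_zero}, 'm) aset \<Rightarrow> ('a, 'n) aset \<Rightarrow> ('m \<Rightarrow> 'n) \<Rightarrow> bool" where
  "admissible_mono M N i \<longleftrightarrow>
     (\<exists>(K :: ('a, 'n) aset) j. admissible_ses M N K i j \<and>
        projective M \<and> projective N \<and> projective K)"

definition admissible_epi ::
  "('a::{monoid_mult, mult_zero}, 'n) aset \<Rightarrow> ('a, 'k) aset \<Rightarrow> ('n \<Rightarrow> 'k) \<Rightarrow> bool" where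
  "admissible_epi N K j \<longleftrightarrow>
     (\<exists>(M :: ('a, 'n) aset) i. admissible_ses M N K i j \<and>
        projective M \<and> projective N \<and> projective K)"

definition fiber_product ::
  "('a, 'k) aset \<Rightarrow> ('a, 'n) aset \<Rightarrow> ('k \<Rightarrow> 'm) \<Rightarrow> ('n \<Rightarrow> 'm) \<Rightarrow> ('a, 'k \<times> 'n) aset" where
  "fiber_product K N f g =
     \<lparr>points = {(k, n). k \<in> points K \<and> n \<in> points N \<and> f k = g n},
      pt = (pt K, pt N),
      act = (\<lambda>a (k, n). (act K a k, act N a n))\<rparr>"

text \<open>
  \<open>P\<close> with projections \<open>p\<close>, \<open>q\<close> is a commutative square over \<open>K \<longrightarrow> M \<longleftarrow> N\<close> through which every
  commutative square with vertex \<open>T\<close> factors uniquely. The type of \<open>T\<close> is a parameter, to be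
  universally quantified where the predicate is used.
\<close>

definition is_fiber_product ::
  "'t itself \<Rightarrow> ('a::{monoid_mult, mult_zero}, 'k) aset \<Rightarrow> ('a, 'm) aset \<Rightarrow> ('a, 'n) aset \<Rightarrow>
   ('k \<Rightarrow> 'm) \<Rightarrow> ('n \<Rightarrow> 'm) \<Rightarrow> ('a, 'p) aset \<Rightarrow> ('p \<Rightarrow> 'k) \<Rightarrow> ('p \<Rightarrow> 'n) \<Rightarrow> bool" where
  "is_fiber_product _ K M N f g P p q \<longleftrightarrow>
     aset_hom K M f \<and> aset_hom N M g \<and> aset_hom P K p \<and> aset_hom P N q \<and>
     (\<forall>x\<in>points P. f (p x) = g (q x)) \<and>
     (\<forall>(T :: ('a, 't) aset) u v.
        aset_hom T K u \<and> aset_hom T N v \<and> (\<forall>t\<in>points T. f (u t) = g (v t)) \<longrightarrow>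
        (\<exists>h. aset_hom T P h \<and> (\<forall>t\<in>points T. p (h t) = u t \<and> q (h t) = v t) \<and>
           (\<forall>h'. aset_hom T P h' \<and> (\<forall>t\<in>points T. p (h' t) = u t \<and> q (h' t) = v t) \<longrightarrow>
              (\<forall>t\<in>points T. h' t = h t))))"


subsection \<open>Independence of the choice of carrier types\<close>

definition transport :: "('m \<Rightarrow> 'n) \<Rightarrow> ('a, 'm) aset \<Rightarrow> ('a, 'n) aset" where
  "transport e M =
     \<lparr>points = e ` points M, pt = e (pt M), act = (\<lambda>a x. e (act M a (inv_into (points M) e x)))\<rparr>"

lemma aset_hom_compose:
  assumes "aset_hom M N f" "aset_hom N K g"
  shows "aset_hom M K (\<lambda>x. g (f x))"
  using assms unfolding aset_hom_def by auto

lemma is_aset_transport: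
  assumes "is_aset M" "inj_on e (points M)"
  shows "is_aset (transport e M)"
  using assms unfolding is_aset_def transport_def by auto

lemma aset_hom_transport:
  assumes "is_aset M" "inj_on e (points M)"
  shows "aset_hom M (transport e M) e"
  using assms is_aset_transport[OF assms] unfolding aset_hom_def
  by (auto simp: transport_def)

lemma aset_hom_transport_inv:
  assumes "is_aset M" "inj_on e (points M)"
  shows "aset_hom (transport e M) M (inv_into (points M) e)"
proof -
  have "pt M \<in> points M" "\<And>a m. m \<in> points M \<Longrightarrow> act M a m \<in> points M"
    using assms(1) unfolding is_aset_def by auto
  then show ?thesis
    using assms is_aset_transport[OF assms] unfolding aset_hom_def
    by (auto simp: transport_def)
qed

lemma projective_lift:
  fixes P :: "('a::{monoid_mult, mult_zero}, 'm) aset"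
    and M :: "('a, 'x) aset" and N :: "('a, 'y) aset"
  assumes P: "projective P" and g: "aset_hom M N g" "g ` points M = points N"
    and f: "aset_hom P N f"
  obtains h where "aset_hom P M h" "\<And>p. p \<in> points P \<Longrightarrow> g (h p) = f p"
proof -
  have aP: "is_aset P" and aM: "is_aset M" and aN: "is_aset N"
    using P g(1) unfolding projective_def aset_hom_def by auto
  have "\<forall>p. \<exists>m. p \<in> points P \<longrightarrow> m \<in> points M \<and> g m = f p"
  proof
    fix p
    have "p \<in> points P \<Longrightarrow> f p \<in> g ` points M"
      using f g(2) unfolding aset_hom_def by auto
    then show "\<exists>m. p \<in> points P \<longrightarrow> m \<in> points M \<and> g m = f p" by force
  qed
  then obtain c where c: "\<And>p. p \<in> points P \<Longrightarrow> c p \<in> points M"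
      "\<And>p. p \<in> points P \<Longrightarrow> g (c p) = f p"
    by metis
  define \<phi> where "\<phi> = (\<lambda>(a, p). act M a (c p))"
  define D where "D = (UNIV :: 'a set) \<times> points P"
  define M' where "M' = M\<lparr>points := \<phi> ` D\<rparr>"
  define N' where "N' = N\<lparr>points := f ` points P\<rparr>"
  have \<phi>M: "\<phi> ` D \<subseteq> points M"
    using c aM unfolding \<phi>_def D_def is_aset_def by auto
  have ptP: "pt P \<in> points P" using aP unfolding is_aset_def by auto
  have ptM': "pt M = \<phi> (0, pt P)"
    using c(1)[OF ptP] aM unfolding \<phi>_def is_aset_def by auto
  have clM': "act M a (\<phi> (b, p)) = \<phi> (a * b, p)" if "p \<in> points P" for a b p
    using c(1)[OF that] aM unfolding \<phi>_def is_aset_def by auto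
  have aM': "is_aset M'"
    unfolding is_aset_def
  proof (intro conjI)
    show "pt M' \<in> points M'" unfolding M'_def D_def using ptM' ptP by auto
    show "\<forall>a. \<forall>m\<in>points M'. act M' a m \<in> points M'"
      unfolding M'_def D_def using clM' by auto
  qed (use aM \<phi>M in \<open>auto simp: is_aset_def M'_def subset_iff\<close>)
  have aN': "is_aset N'"
    unfolding is_aset_def
  proof (intro conjI)
    show "pt N' \<in> points N'" unfolding N'_def using f ptP by (auto simp: aset_hom_def intro!: image_eqI[of _ f "pt P"])
    show "\<forall>a. \<forall>m\<in>points N'. act N' a m \<in> points N'"
    proof (intro allI ballI)
      fix a m assume "m \<in> points N'"
      then obtain p where p: "p \<in> points P" "m = f p" by (auto simp: N'_def)
      then have "act N' a m = f (act P a p)" using f by (auto simp: N'_def aset_hom_def)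
      moreover have "act P a p \<in> points P" using aP p by (auto simp: is_aset_def)
      ultimately show "act N' a m \<in> points N'" by (simp add: N'_def)
    qed
  qed (use aN f in \<open>auto simp: is_aset_def N'_def aset_hom_def\<close>)
  have g\<phi>: "g (\<phi> (a, p)) = f (act P a p)" if "p \<in> points P" for a p
    using that c[OF that] g(1) f unfolding \<phi>_def aset_hom_def by auto
  have clP: "act P a p \<in> points P" if "p \<in> points P" for a p
    using aP that unfolding is_aset_def by auto
  have gM': "g x \<in> f ` points P" if "x \<in> points M'" for x
    using that g\<phi> clP unfolding M'_def D_def by auto
  have hg: "aset_hom M' N' g"
    using g(1) aM' aN' gM' \<phi>M unfolding aset_hom_def by (auto simp: M'_def N'_def subset_iff)
  have sg: "g ` points M' = points N'"
  proof
    show "g ` points M' \<subseteq> points N'" using gM' by (auto simp: N'_def)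
    show "points N' \<subseteq> g ` points M'"
    proof
      fix y assume "y \<in> points N'"
      then obtain p where p: "p \<in> points P" "y = f p" by (auto simp: N'_def)
      have "\<phi> (1, p) \<in> points M'" using p by (auto simp: M'_def D_def)
      moreover have "g (\<phi> (1, p)) = y" using g\<phi>[OF p(1)] aP p by (auto simp: is_aset_def)
      ultimately show "y \<in> g ` points M'" by force
    qed
  qed
  have hf: "aset_hom P N' f"
    using f aN' unfolding aset_hom_def by (auto simp: N'_def)
  define e where "e = inv_into D \<phi>"
  define d where "d = (\<lambda>y. (1 :: 'a, inv_into (points P) f y))"
  have ie: "inj_on e (points M')"
    unfolding e_def M'_def by (simp add: inj_on_inv_into)
  have "inj_on (inv_into (points P) f) (f ` points P)"
    by (rule inj_on_inv_into) simp
  then have id: "inj_on d (points N')"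
    by (auto simp: d_def N'_def inj_on_def)
  let ?M = "transport e M'" and ?N = "transport d N'"
  let ?r = "inv_into (points M') e"
  have r: "aset_hom ?M M' ?r" by (rule aset_hom_transport_inv[OF aM' ie])
  have dh: "aset_hom N' ?N d" by (rule aset_hom_transport[OF aN' id])
  have 1: "aset_hom ?M ?N (\<lambda>x. d (g (?r x)))"
    by (rule aset_hom_compose[OF aset_hom_compose[OF r hg] dh])
  have rs: "?r ` points ?M = points M'"
    using ie by (auto simp: transport_def image_image)
  have 2: "(\<lambda>x. d (g (?r x))) ` points ?M = points ?N"
  proof -
    have "(\<lambda>x. d (g (?r x))) ` points ?M = d ` (g ` (?r ` points ?M))" by (simp add: image_image)
    also have "\<dots> = points ?N" using rs sg by (simp add: transport_def)
    finally show ?thesis .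
  qed
  have 3: "aset_hom P ?N (\<lambda>x. d (f x))"
    by (rule aset_hom_compose[OF hf dh])
  have lift: "\<And>(M :: ('a, 'a \<times> 'm) aset) (N :: ('a, 'a \<times> 'm) aset) g f.
      aset_hom M N g \<Longrightarrow> g ` points M = points N \<Longrightarrow> aset_hom P N f \<Longrightarrow>
      \<exists>h. aset_hom P M h \<and> (\<forall>p\<in>points P. g (h p) = f p)"
    using P unfolding projective_def by blast
  obtain h where h: "aset_hom P ?M h" "\<And>p. p \<in> points P \<Longrightarrow> d (g (?r (h p))) = d (f p)"
    using lift[OF 1 2 3] by (elim exE conjE) (erule that, erule bspec)
  have rh: "aset_hom P M' (\<lambda>x. ?r (h x))"
    by (rule aset_hom_compose[OF h(1) r])
  have "aset_hom P M (\<lambda>x. ?r (h x))"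
    using rh aM \<phi>M unfolding aset_hom_def by (auto simp: M'_def subset_iff)
  moreover have "g (?r (h p)) = f p" if p: "p \<in> points P" for p
  proof -
    have "g (?r (h p)) \<in> points N'" "f p \<in> points N'"
      using p rh hg hf unfolding aset_hom_def by auto
    then show ?thesis using h(2)[OF p] id by (auto dest: inj_onD)
  qed
  ultimately show thesis using that by blast
qed

lemma projective_iso:
  fixes P :: "('a::{monoid_mult, mult_zero}, 'm) aset" and Q :: "('a, 'n) aset"
  assumes P: "projective P" and iso: "aset_iso P Q e"
  shows "projective Q"
proof -
  obtain r where e: "aset_hom P Q e" and r: "aset_hom Q P r"
    and er: "\<And>q. q \<in> points Q \<Longrightarrow> e (r q) = q"
    using iso unfolding aset_iso_def by auto
  show ?thesis
    unfolding projective_def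
  proof (intro conjI allI impI)
    show "is_aset Q" using e unfolding aset_hom_def by auto
    fix M N :: "('a, 'a \<times> 'n) aset" and g f
    assume *: "aset_hom M N g \<and> g ` points M = points N \<and> aset_hom Q N f"
    have "aset_hom P N (\<lambda>x. f (e x))" using aset_hom_compose[OF e] * by blast
    then obtain h where h: "aset_hom P M h" "\<And>p. p \<in> points P \<Longrightarrow> g (h p) = f (e p)"
      using projective_lift[OF P, of M N g] * by blast
    have "aset_hom Q M (\<lambda>x. h (r x))" by (rule aset_hom_compose[OF r h(1)])
    moreover have "\<forall>q\<in>points Q. g (h (r q)) = f q"
      using h(2) er r unfolding aset_hom_def by auto
    ultimately show "\<exists>h. aset_hom Q M h \<and> (\<forall>q\<in>points Q. g (h q) = f q)" by blast
  qed
qed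

lemma aset_iso_transport:
  assumes "is_aset M" "inj_on e (points M)"
  shows "aset_iso M (transport e M) e"
  unfolding aset_iso_def
  using aset_hom_transport[OF assms] aset_hom_transport_inv[OF assms] assms(2)
  by (intro conjI exI[of _ "inv_into (points M) e"]) (auto simp: transport_def)

lemma admissible_monoI:
  fixes K :: "('a::{monoid_mult, mult_zero}, 'k) aset"
  assumes s: "admissible_ses M N K i j"
    and p: "projective M" "projective N" "projective K"
  shows "admissible_mono M N i"
proof -
  have i: "normal_hom M N i" and j: "normal_hom N K j" and kj: "aset_kernel N K j = i ` points M"
    and ki: "aset_kernel M N i = {pt M}" and sj: "points K = j ` points N"
    using s unfolding admissible_ses_def by auto
  define e where "e = inv_into (points N) j"
  have aK: "is_aset K" using p(3) unfolding projective_def by auto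
  have inj: "inj_on e (points K)"
    unfolding e_def sj by (rule inj_on_inv_into) simp
  let ?K = "transport e K"
  have eh: "aset_hom K ?K e" by (rule aset_hom_transport[OF aK inj])
  have jh: "aset_hom N K j" using j unfolding normal_hom_def by auto
  have ej: "aset_hom N ?K (\<lambda>x. e (j x))" by (rule aset_hom_compose[OF jh eh])
  have jK: "\<And>n. n \<in> points N \<Longrightarrow> j n \<in> points K" and "pt K \<in> points K"
    using sj aK unfolding is_aset_def by auto
  then have ker: "aset_kernel N ?K (\<lambda>x. e (j x)) = aset_kernel N K j"
    using inj by (auto simp: aset_kernel_def transport_def dest: inj_onD)
  have "inj_on (\<lambda>x. e (j x)) (points N - aset_kernel N K j)"
    using j inj jK unfolding normal_hom_def by (auto simp: inj_on_def)
  then have "normal_hom N ?K (\<lambda>x. e (j x))"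
    using ej ker unfolding normal_hom_def by auto
  then have "admissible_ses M N ?K i (\<lambda>x. e (j x))"
    unfolding admissible_ses_def using i ki kj ker sj by (auto simp: transport_def)
  moreover have "projective ?K"
    by (rule projective_iso[OF p(3) aset_iso_transport[OF aK inj]])
  ultimately show ?thesis unfolding admissible_mono_def using p by blast
qed

lemma admissible_epiI:
  fixes M :: "('a::{monoid_mult, mult_zero}, 'm) aset"
  assumes s: "admissible_ses M N K i j"
    and p: "projective M" "projective N" "projective K"
  shows "admissible_epi N K j"
proof -
  have i: "normal_hom M N i" and j: "normal_hom N K j" and kj: "aset_kernel N K j = i ` points M"
    and ki: "aset_kernel M N i = {pt M}" and sj: "points K = j ` points N"
    using s unfolding admissible_ses_def by auto
  have aM: "is_aset M" and aN: "is_aset N" using p unfolding projective_def by auto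
  have ih: "aset_hom M N i" using i unfolding normal_hom_def by auto
  have inj: "inj_on i (points M)"
  proof (rule inj_onI)
    fix x y assume xy: "x \<in> points M" "y \<in> points M" "i x = i y"
    have "inj_on i (points M - {pt M})" using i ki unfolding normal_hom_def by auto
    moreover have "i z = pt N \<longleftrightarrow> z = pt M" if "z \<in> points M" for z
      using ki that unfolding aset_kernel_def by blast
    then have "x = pt M \<longleftrightarrow> y = pt M" using xy by metis
    ultimately show "x = y" using xy unfolding inj_on_def by blast
  qed
  let ?M = "transport i M"
  have iM: "\<And>m. m \<in> points M \<Longrightarrow> i m \<in> points N" "i (pt M) = pt N"
    using ih unfolding aset_hom_def by auto
  have "pt M \<in> points M" "\<And>a m. m \<in> points M \<Longrightarrow> act M a m \<in> points M"
    using aM unfolding is_aset_def by auto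
  then have h: "aset_hom ?M N (\<lambda>x. x)"
    using is_aset_transport[OF aM inj] aN ih inj unfolding aset_hom_def
    by (auto simp: transport_def)
  have "aset_kernel ?M N (\<lambda>x. x) = {pt ?M}"
    using iM \<open>pt M \<in> points M\<close> by (force simp: aset_kernel_def transport_def)
  then have "admissible_ses ?M N K (\<lambda>x. x) j"
    unfolding admissible_ses_def normal_hom_def using h j kj sj
    by (auto simp: transport_def normal_hom_def)
  moreover have "projective ?M"
    by (rule projective_iso[OF p(1) aset_iso_transport[OF aM inj]])
  ultimately show ?thesis unfolding admissible_epi_def using p by blast
qed

end

theory Submission imports Defs begin

text \<open>
  Since \<open>K\<close> is projective, an admissible sequence \<open>0 \<longrightarrow> M \<longrightarrow> N \<longrightarrow> K \<longrightarrow> 0\<close> splits, and as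
  \<open>N \<longrightarrow> K\<close> is injective off its kernel, \<open>N\<close> is the wedge sum of the image of \<open>M\<close> and of \<open>K\<close>: the
  complement of the image of \<open>M\<close> is stable under the action up to the base point. Conversely, both
  parts of such a decomposition of a projective \<open>N\<close> are retracts of \<open>N\<close>, by collapsing the other
  part, hence projective. So being an admissible monomorphism or epimorphism is an elementwise
  condition on the action, and this condition is easily checked for composites and fiber products.
\<close>

section \<open>Retracts, splittings and complemented sub-\<open>A\<close>-sets\<close>

text \<open>A map out of \<open>Q\<close> is extended to \<open>P\<close> along \<open>r\<close>,
  lifted there, and restricted back along \<open>s\<close>. The lift comes from
  \<open>projective_lift\<close>, since the test objects for \<open>Q\<close> need not be carried by
  the type used in the definition for \<open>P\<close>.\<close>

lemma projective_retract:
  fixes P :: "('a::{monoid_mult, mult_zero}, 'm) aset" and Q :: "('a, 'n) aset"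
  assumes P: "projective P" and s: "aset_hom Q P s" and r: "aset_hom P Q r"
    and rs: "\<And>q. q \<in> points Q \<Longrightarrow> r (s q) = q"
  shows "projective Q"
  unfolding projective_def
proof (intro conjI allI impI)
  show "is_aset Q" using s unfolding aset_hom_def by auto
  fix M N :: "('a, 'a \<times> 'n) aset" and g f
  assume *: "aset_hom M N g \<and> g ` points M = points N \<and> aset_hom Q N f"
  have "aset_hom P N (\<lambda>x. f (r x))" using aset_hom_compose[OF r] * by blast
  then obtain h where h: "aset_hom P M h" "\<And>p. p \<in> points P \<Longrightarrow> g (h p) = f (r p)"
    using projective_lift[OF P, of M N g] * by blast
  have "aset_hom Q M (\<lambda>x. h (s x))" by (rule aset_hom_compose[OF s h(1)])
  moreover have "\<forall>q\<in>points Q. g (h (s q)) = f q"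
    using h(2) rs s unfolding aset_hom_def by auto
  ultimately show "\<exists>h. aset_hom Q M h \<and> (\<forall>q\<in>points Q. g (h q) = f q)" by blast
qed

lemma aset_hom_id: "is_aset M \<Longrightarrow> aset_hom M M (\<lambda>x. x)"
  unfolding aset_hom_def by auto

text \<open>Normality separates the points off the kernel, and no point other than
  \<open>pt M\<close> goes to the base point.\<close>

lemma normal_hom_inj_on:
  assumes "normal_hom M N f" "aset_kernel M N f = {pt M}"
  shows "inj_on f (points M)"
proof (rule inj_onI)
  fix x y assume xy: "x \<in> points M" "y \<in> points M" "f x = f y"
  have "inj_on f (points M - {pt M})" using assms unfolding normal_hom_def by auto
  moreover have "f z = pt N \<longleftrightarrow> z = pt M" if "z \<in> points M" for z
    using assms(2) that unfolding aset_kernel_def by blast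
  then have "x = pt M \<longleftrightarrow> y = pt M" using xy by metis
  ultimately show "x = y" using xy unfolding inj_on_def by blast
qed

text \<open>Projectivity of \<open>K\<close> splits \<open>j\<close>. Off the kernel the section
  inverts \<open>j\<close>, so the action on \<open>n\<close> is the image of the action on
  \<open>j n\<close>, and a section sends the base point to the base point.\<close>

lemma normal_epi_act_kernel:
  assumes j: "normal_hom N K j" and sj: "j ` points N = points K" and K: "projective K"
    and n: "n \<in> points N" "j n \<noteq> pt K" and an: "j (act N a n) = pt K"
  shows "act N a n = pt N"
proof -
  have jh: "aset_hom N K j" and inj: "inj_on j (points N - aset_kernel N K j)"
    using j unfolding normal_hom_def by auto
  have "is_aset K" using jh unfolding aset_hom_def by auto
  then obtain s where s: "aset_hom K N s" "\<And>k. k \<in> points K \<Longrightarrow> j (s k) = k"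
    using projective_lift[OF K jh sj aset_hom_id] by blast
  have jn: "j n \<in> points K" using n(1) sj by blast
  then have "s (j n) \<in> points N" using s(1) unfolding aset_hom_def by blast
  \<comment> \<open>Both points are sent by \<open>j\<close> to \<open>j n\<close>, which is not
    \<open>pt K\<close>, so both lie where \<open>j\<close> is injective.\<close>
  then have "s (j n) = n"
    using inj n s(2)[OF jn] unfolding aset_kernel_def inj_on_def by auto
  then have "act N a n = s (act K a (j n))"
    using s(1) jn unfolding aset_hom_def by metis
  also have "\<dots> = s (pt K)"
    using an jh n(1) unfolding aset_hom_def by metis
  also have "\<dots> = pt N" using s(1) unfolding aset_hom_def by blast
  finally show ?thesis .
qed

text \<open>Collapsing the complement of the image to the base point retracts \<open>N\<close> onto
  \<open>M\<close>. Condition \<open>c\<close> is what makes the collapse equivariant: an element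
  that enters the image from outside enters it at the base point.\<close>

lemma projective_complemented:
  assumes N: "projective N" and f: "aset_hom M N f" and inj: "inj_on f (points M)"
    and c: "\<And>a n. n \<in> points N \<Longrightarrow> n \<notin> f ` points M \<Longrightarrow> act N a n \<in> f ` points M \<Longrightarrow> act N a n = pt N"
  shows "projective M"
proof -
  define r where "r = (\<lambda>n. if n \<in> f ` points M then inv_into (points M) f n else pt M)"
  have rf: "r (f m) = m" if "m \<in> points M" for m
    using that inj by (simp add: r_def)
  have M: "pt M \<in> points M" "\<And>a m. m \<in> points M \<Longrightarrow> act M a m \<in> points M"
      "\<And>a. act M a (pt M) = pt M"
    using f unfolding aset_hom_def is_aset_def by auto
  have fM: "f (pt M) = pt N" "\<And>a m. m \<in> points M \<Longrightarrow> act N a (f m) = f (act M a m)"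
    using f unfolding aset_hom_def by auto
  have rpt: "r (pt N) = pt M" using rf[OF M(1)] fM(1) by simp
  have "r (act N a n) = act M a (r n)" if n: "n \<in> points N" for a n
  proof (cases "n \<in> f ` points M")
    case True
    then obtain m where "m \<in> points M" "n = f m" by auto
    then show ?thesis using rf M(2) fM(2) by simp
  next
    case False
    then have "r n = pt M" by (simp add: r_def)
    \<comment> \<open>If the action leads into the image, \<open>c\<close> forces the value
      \<open>pt N\<close>; otherwise the point is collapsed anyway.\<close>
    moreover have "r (act N a n) = pt M"
    proof (cases "act N a n \<in> f ` points M")
      case True
      then show ?thesis using c[OF n False] rpt by simp
    qed (simp add: r_def)
    ultimately show ?thesis using M(3) by simp
  qed
  moreover have "r n \<in> points M" for n
    using M(1) rf by (auto simp: r_def inv_into_into)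
  ultimately have "aset_hom N M r"
    using f rpt unfolding aset_hom_def by auto
  then show ?thesis using projective_retract[OF N f] rf by blast
qed

section \<open>Elementwise criteria for admissible morphisms\<close>

text \<open>From left to right, the image of \<open>f\<close> is the kernel of a split normal
  epimorphism, so \<open>normal_epi_act_kernel\<close> applies. From right to left, the cokernel is
  built as a complement inside \<open>N\<close>, and \<open>M\<close> and the cokernel are
  projective as retracts of \<open>N\<close>.\<close>

lemma admissible_mono_iff:
  "admissible_mono M N f \<longleftrightarrow>
     projective N \<and> aset_hom M N f \<and> inj_on f (points M) \<and>
     (\<forall>a. \<forall>n\<in>points N. n \<notin> f ` points M \<longrightarrow> act N a n \<in> f ` points M \<longrightarrow> act N a n = pt N)"
  (is "?L \<longleftrightarrow> ?R")
proof
  assume ?L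
  then obtain K :: "('a, 'c) aset" and j where s: "admissible_ses M N K f j"
    and p: "projective N" "projective K"
    unfolding admissible_mono_def by blast
  have f: "normal_hom M N f" and j: "normal_hom N K j" and kj: "aset_kernel N K j = f ` points M"
    and kf: "aset_kernel M N f = {pt M}" and sj: "j ` points N = points K"
    using s unfolding admissible_ses_def by auto
  have ker: "x \<in> f ` points M \<longleftrightarrow> x \<in> points N \<and> j x = pt K" for x
    using kj unfolding aset_kernel_def by blast
  have "act N a n = pt N"
    if "n \<in> points N" "n \<notin> f ` points M" "act N a n \<in> f ` points M" for a n
    using normal_epi_act_kernel[OF j sj p(2)] that ker by blast
  then show ?R
    using p(1) f normal_hom_inj_on[OF f kf] unfolding normal_hom_def by blast
next
  assume R: ?R
  then have N: "projective N" and f: "aset_hom M N f" and inj: "inj_on f (points M)"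
    and c: "\<And>a n. n \<in> points N \<Longrightarrow> n \<notin> f ` points M \<Longrightarrow> act N a n \<in> f ` points M \<Longrightarrow> act N a n = pt N"
    by blast+
  have aM: "is_aset M" and aN: "is_aset N" and fM: "\<And>m. m \<in> points M \<Longrightarrow> f m \<in> points N"
      "f (pt M) = pt N" "\<And>a m. m \<in> points M \<Longrightarrow> act N a (f m) = f (act M a m)"
    using f unfolding aset_hom_def by auto
  have ptM: "pt M \<in> points M" and clM: "\<And>a m. m \<in> points M \<Longrightarrow> act M a m \<in> points M"
    using aM unfolding is_aset_def by auto
  have ptN: "pt N \<in> points N" "pt N \<in> f ` points M"
    and clN: "\<And>a n. n \<in> points N \<Longrightarrow> act N a n \<in> points N" "\<And>a. act N a (pt N) = pt N"
    using aN ptM fM(2) unfolding is_aset_def by (auto intro: image_eqI[of _ f "pt M"])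
  have clf: "act N a n \<in> f ` points M" if "n \<in> f ` points M" for a n
    using that fM(3) clM by auto
  \<comment> \<open>A model of the quotient of \<open>N\<close> by the image of \<open>f\<close>:
    the complement with the base point put back. Condition \<open>c\<close> makes it closed under
    the action, and likewise makes the collapse \<open>j\<close> equivariant; the inclusion is a
    section of \<open>j\<close>.\<close>
  define C where "C = N\<lparr>points := insert (pt N) (points N - f ` points M)\<rparr>"
  have C: "points C = insert (pt N) (points N - f ` points M)" "pt C = pt N" "act C = act N"
    by (simp_all add: C_def)
  define j where "j = (\<lambda>n. if n \<in> f ` points M then pt N else n)"
  have aC: "is_aset C"
    using aN c unfolding is_aset_def C by auto
  have inc: "aset_hom C N (\<lambda>x. x)"
    using aC aN ptN(1) unfolding aset_hom_def C by auto
  have j: "aset_hom N C j"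
    unfolding aset_hom_def
  proof (intro conjI allI ballI)
    fix a n assume n: "n \<in> points N"
    show "j n \<in> points C" using n by (simp add: C j_def)
    show "j (act N a n) = act C a (j n)"
    proof (cases "n \<in> f ` points M")
      case True
      then show ?thesis using clf clN(2) by (simp add: C j_def)
    next
      case False
      then show ?thesis using c[OF n False] by (simp add: C j_def)
    qed
  qed (use aN aC in \<open>simp_all add: C j_def\<close>)
  have jC: "j x = x" if "x \<in> points C" for x
    using that unfolding C j_def by auto
  have "projective C"
    using projective_retract[OF N inc j] jC by blast
  moreover have "admissible_ses M N C f j"
    unfolding admissible_ses_def normal_hom_def
  proof (intro conjI)
    show "aset_kernel M N f = {pt M}"
    proof -
      have "m = pt M" if "m \<in> points M" "f m = pt N" for m
        using that inj fM(2) ptM by (metis inj_onD)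
      then show ?thesis using fM(2) ptM unfolding aset_kernel_def by blast
    qed
    show ker: "aset_kernel N C j = f ` points M"
      using fM(1) ptN(2) unfolding aset_kernel_def C j_def by auto
    show "inj_on j (points N - aset_kernel N C j)"
      unfolding ker by (auto simp: inj_on_def j_def)
    show "points C = j ` points N"
    proof
      have "points C \<subseteq> points N" using C(1) ptN(1) by auto
      then show "points C \<subseteq> j ` points N"
        using jC by (force simp: image_iff)
      show "j ` points N \<subseteq> points C" using C(1) by (auto simp: j_def)
    qed
  qed (use f j inj in \<open>auto intro: inj_on_subset\<close>)
  ultimately show ?L
    using admissible_monoI projective_complemented[OF N f inj c] N by blast
qed

text \<open>The dual criterion: the missing left term is the kernel of \<open>j\<close>. Here the
  complement of the image is the set where \<open>j\<close> is not the base point, so the last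
  clause is the hypothesis \<open>c\<close> of \<open>projective_complemented\<close> for the
  inclusion of the kernel.\<close>

lemma admissible_epi_iff:
  "admissible_epi N K j \<longleftrightarrow>
     projective N \<and> projective K \<and> normal_hom N K j \<and> j ` points N = points K \<and>
     (\<forall>a. \<forall>n\<in>points N. j n \<noteq> pt K \<longrightarrow> j (act N a n) = pt K \<longrightarrow> act N a n = pt N)"
  (is "?L \<longleftrightarrow> ?R")
proof
  assume ?L
  then obtain M :: "('a, 'b) aset" and i where s: "admissible_ses M N K i j"
    and p: "projective N" "projective K"
    unfolding admissible_epi_def by blast
  have j: "normal_hom N K j" and sj: "j ` points N = points K"
    using s unfolding admissible_ses_def by auto
  then show ?R
    using normal_epi_act_kernel[OF j sj p(2)] p by blast
next
  assume R: ?R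
  then have N: "projective N" and K: "projective K" and nj: "normal_hom N K j"
    and sj: "j ` points N = points K"
    and c: "\<And>a n. n \<in> points N \<Longrightarrow> j n \<noteq> pt K \<Longrightarrow> j (act N a n) = pt K \<Longrightarrow> act N a n = pt N"
    by blast+
  have j: "aset_hom N K j" using nj unfolding normal_hom_def by auto
  have aN: "is_aset N" and aK: "is_aset K" using j unfolding aset_hom_def by auto
  define M where "M = N\<lparr>points := aset_kernel N K j\<rparr>"
  have M: "points M = aset_kernel N K j" "pt M = pt N" "act M = act N"
    by (simp_all add: M_def)
  have aM: "is_aset M"
    using aN aK j unfolding is_aset_def aset_hom_def M aset_kernel_def by auto
  have inc: "aset_hom M N (\<lambda>x. x)"
    using aM aN unfolding aset_hom_def M aset_kernel_def by auto
  have "projective M"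
    by (rule projective_complemented[OF N inc]) (use c in \<open>auto simp: M aset_kernel_def\<close>)
  moreover have "admissible_ses M N K (\<lambda>x. x) j"
    using inc nj sj aM unfolding admissible_ses_def normal_hom_def
    by (auto simp: aset_kernel_def M is_aset_def)
  ultimately show ?L
    using admissible_epiI N K by blast
qed

section \<open>Isomorphisms are admissible\<close>

lemma aset_iso_bij:
  assumes "aset_iso M N e"
  shows "inj_on e (points M)" "e ` points M = points N"
proof -
  obtain r where e: "aset_hom M N e" and r: "aset_hom N M r"
    and re: "\<forall>m\<in>points M. r (e m) = m" and er: "\<forall>n\<in>points N. e (r n) = n"
    using assms unfolding aset_iso_def by auto
  show "inj_on e (points M)" using re by (metis inj_on_inverseI)
  show "e ` points M = points N"
    using e r er unfolding aset_hom_def by (metis image_subset_iff image_eqI subsetI subset_antisym)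
qed

text \<open>The image is all of \<open>N\<close>, so the condition on its complement is
  vacuous.\<close>

lemma admissible_mono_iso:
  assumes "aset_iso M N e" "projective N"
  shows "admissible_mono M N e"
  using assms aset_iso_bij[OF assms(1)] unfolding admissible_mono_iff aset_iso_def by blast

text \<open>By injectivity only \<open>pt M\<close> goes to \<open>pt N\<close>, which settles the
  condition on the action at once.\<close>

lemma admissible_epi_iso:
  assumes e: "aset_iso M N e" and M: "projective M"
  shows "admissible_epi M N e"
proof -
  have h: "aset_hom M N e" using e unfolding aset_iso_def by blast
  have b: "inj_on e (points M)" "e ` points M = points N" by (rule aset_iso_bij[OF e])+
  have "act M a m = pt M" if "m \<in> points M" "e (act M a m) = pt N" for a m
    using that b(1) h unfolding aset_hom_def is_aset_def inj_on_def by metis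
  then show ?thesis
    using M projective_iso[OF M e] b h unfolding admissible_epi_iff normal_hom_def
    by (blast intro: inj_on_subset)
qed

section \<open>Composition of admissible morphisms\<close>

text \<open>A point outside the image of \<open>g\<close> is handled by the condition for
  \<open>g\<close>; a point inside comes from \<open>M\<close>, where the condition for
  \<open>f\<close> applies.\<close>

lemma admissible_mono_comp:
  assumes f: "admissible_mono L M f" and g: "admissible_mono M N g"
  shows "admissible_mono L N (g \<circ> f)"
proof -
  have fh: "aset_hom L M f" and fi: "inj_on f (points L)"
    and fc: "\<And>a m. m \<in> points M \<Longrightarrow> m \<notin> f ` points L \<Longrightarrow> act M a m \<in> f ` points L \<Longrightarrow> act M a m = pt M"
    using f unfolding admissible_mono_iff by auto
  have gh: "aset_hom M N g" and gi: "inj_on g (points M)" and N: "projective N"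
    and gc: "\<And>a n. n \<in> points N \<Longrightarrow> n \<notin> g ` points M \<Longrightarrow> act N a n \<in> g ` points M \<Longrightarrow> act N a n = pt N"
    using g unfolding admissible_mono_iff by auto
  have fL: "f ` points L \<subseteq> points M" using fh unfolding aset_hom_def by auto
  have "act N a n = pt N"
    if n: "n \<in> points N" "n \<notin> (g \<circ> f) ` points L" "act N a n \<in> (g \<circ> f) ` points L" for a n
  proof (cases "n \<in> g ` points M")
    case False
    moreover have "act N a n \<in> g ` points M" using n(3) fL by auto
    ultimately show ?thesis using gc[OF n(1)] by blast
  next
    case True
    then obtain m where m: "m \<in> points M" "n = g m" by auto
    have am: "act M a m \<in> points M" "act N a n = g (act M a m)"
      using gh m unfolding aset_hom_def is_aset_def by auto
    obtain l where l: "l \<in> points L" "act N a n = g (f l)" using n(3) by auto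
    \<comment> \<open>Injectivity of \<open>g\<close> carries the situation back from
      \<open>N\<close> to \<open>M\<close>.\<close>
    then have "act M a m = f l" using am gi fL by (metis image_subset_iff inj_onD)
    moreover have "m \<notin> f ` points L" using n(2) m(2) by auto
    ultimately have "act M a m = pt M" using fc[OF m(1)] l(1) by blast
    then show ?thesis using am(2) gh unfolding aset_hom_def by simp
  qed
  then show ?thesis
    using N aset_hom_compose[OF fh gh] comp_inj_on[OF fi] inj_on_subset[OF gi fL]
    unfolding admissible_mono_iff comp_def by blast
qed

text \<open>If the action kills \<open>g (f x)\<close>, the condition for \<open>g\<close> at
  \<open>f x\<close> shows that it already kills \<open>f x\<close>; then the condition for
  \<open>f\<close> shows that it kills \<open>x\<close>.\<close>

lemma admissible_epi_comp:
  assumes f: "admissible_epi L M f" and g: "admissible_epi M N g"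
  shows "admissible_epi L N (g \<circ> f)"
proof -
  have fh: "aset_hom L M f" and fi: "inj_on f (points L - aset_kernel L M f)" and L: "projective L"
    and fs: "f ` points L = points M"
    and fc: "\<And>a m. m \<in> points L \<Longrightarrow> f m \<noteq> pt M \<Longrightarrow> f (act L a m) = pt M \<Longrightarrow> act L a m = pt L"
    using f unfolding admissible_epi_iff normal_hom_def by auto
  have gh: "aset_hom M N g" and gi: "inj_on g (points M - aset_kernel M N g)" and N: "projective N"
    and gs: "g ` points M = points N"
    and gc: "\<And>a m. m \<in> points M \<Longrightarrow> g m \<noteq> pt N \<Longrightarrow> g (act M a m) = pt N \<Longrightarrow> act M a m = pt M"
    using g unfolding admissible_epi_iff normal_hom_def by auto
  have fL: "\<And>x. x \<in> points L \<Longrightarrow> f x \<in> points M" "\<And>a x. x \<in> points L \<Longrightarrow> f (act L a x) = act M a (f x)"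
    and gpt: "g (pt M) = pt N"
    using fh gh unfolding aset_hom_def by auto
  have "act L a x = pt L" if x: "x \<in> points L" "g (f x) \<noteq> pt N" "g (f (act L a x)) = pt N" for a x
  proof -
    have "f (act L a x) = pt M" using gc[OF fL(1)[OF x(1)]] x fL(2) by metis
    then show ?thesis using fc x gpt by metis
  qed
  moreover have "inj_on (\<lambda>x. g (f x)) (points L - aset_kernel L N (\<lambda>x. g (f x)))"
  proof (rule inj_onI)
    fix x y
    assume xy: "x \<in> points L - aset_kernel L N (\<lambda>x. g (f x))"
      "y \<in> points L - aset_kernel L N (\<lambda>x. g (f x))" "g (f x) = g (f y)"
    then have "f x \<in> points M - aset_kernel M N g" "f y \<in> points M - aset_kernel M N g"
      using fL(1) by (auto simp: aset_kernel_def)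
    then have "f x = f y" using gi xy(3) by (auto dest: inj_onD)
    \<comment> \<open>The kernel of \<open>f\<close> lies in that of the composite because
      \<open>g\<close> preserves the base point.\<close>
    moreover have "x \<in> points L - aset_kernel L M f" "y \<in> points L - aset_kernel L M f"
      using xy gpt by (auto simp: aset_kernel_def)
    ultimately show "x = y" using fi by (auto dest: inj_onD)
  qed
  ultimately show ?thesis
    using L N aset_hom_compose[OF fh gh] fs gs
    unfolding admissible_epi_iff normal_hom_def comp_def by (auto simp: image_image[symmetric])
qed

section \<open>Invariance under isomorphic squares\<close>

text \<open>Values off the carrier are arbitrary, so functions that agree on the carrier must be
  interchangeable; a commutative square determines its lower map only there.\<close>

lemma aset_hom_cong:
  assumes "\<And>m. m \<in> points M \<Longrightarrow> f m = g m"
    and f: "aset_hom M N f"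
  shows "aset_hom M N g"
proof -
  have "pt M \<in> points M" "\<And>a m. m \<in> points M \<Longrightarrow> act M a m \<in> points M"
    using f unfolding aset_hom_def is_aset_def by auto
  then show ?thesis using f assms(1) unfolding aset_hom_def by metis
qed

lemma admissible_mono_cong:
  assumes eq: "\<And>m. m \<in> points M \<Longrightarrow> f m = g m" and f: "admissible_mono M N f"
  shows "admissible_mono M N g"
proof -
  have im: "f ` points M = g ` points M" using eq by (auto simp: image_iff)
  have "aset_hom M N f" using f unfolding admissible_mono_iff by blast
  then have "aset_hom M N g" by (rule aset_hom_cong[rotated]) (rule eq)
  moreover have "inj_on f (points M) \<longleftrightarrow> inj_on g (points M)" by (rule inj_on_cong) (rule eq)
  ultimately show ?thesis
    using f unfolding admissible_mono_iff im by blast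
qed

lemma admissible_epi_cong:
  assumes eq: "\<And>m. m \<in> points M \<Longrightarrow> f m = g m" and f: "admissible_epi M N f"
  shows "admissible_epi M N g"
proof -
  have im: "f ` points M = g ` points M" using eq by (auto simp: image_iff)
  have ker: "aset_kernel M N f = aset_kernel M N g"
    using eq unfolding aset_kernel_def by auto
  have "aset_hom M N f" using f unfolding admissible_epi_iff normal_hom_def by blast
  then have g: "aset_hom M N g" by (rule aset_hom_cong[rotated]) (rule eq)
  have "inj_on f (points M - aset_kernel M N g)"
    using f unfolding admissible_epi_iff normal_hom_def ker by blast
  then have "inj_on g (points M - aset_kernel M N g)"
    using eq by (simp add: inj_on_def)
  moreover have "\<And>a m. m \<in> points M \<Longrightarrow> act M a m \<in> points M"
    using g unfolding aset_hom_def is_aset_def by auto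
  ultimately show ?thesis
    using f g eq unfolding admissible_epi_iff normal_hom_def im by simp
qed

lemma aset_iso_inverse:
  assumes "aset_iso M N e"
  shows "\<exists>r. aset_iso N M r \<and> (\<forall>m\<in>points M. r (e m) = m) \<and> (\<forall>n\<in>points N. e (r n) = n)"
  using assms unfolding aset_iso_def by blast

text \<open>On the carrier of \<open>M'\<close> the map \<open>f'\<close> is \<beta> after
  \<open>f\<close> after the inverse of \<alpha>, a composite of admissible morphisms as soon as
  \<open>f\<close> is admissible.\<close>

lemma admissible_square:
  assumes a: "aset_iso M M' \<alpha>" and b: "aset_iso N N' \<beta>"
    and f: "aset_hom M N f"
    and sq: "\<And>m. m \<in> points M \<Longrightarrow> \<beta> (f m) = f' (\<alpha> m)"
  shows admissible_mono_square: "admissible_mono M N f \<Longrightarrow> admissible_mono M' N' f'"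
    and admissible_epi_square: "admissible_epi M N f \<Longrightarrow> admissible_epi M' N' f'"
proof -
  obtain \<alpha>' where a': "aset_iso M' M \<alpha>'" "\<forall>m\<in>points M'. \<alpha> (\<alpha>' m) = m"
    using aset_iso_inverse[OF a] by blast
  have "\<alpha>' m \<in> points M" if "m \<in> points M'" for m
    using a'(1) that unfolding aset_iso_def aset_hom_def by auto
  then have eq: "(\<beta> \<circ> (f \<circ> \<alpha>')) m = f' m" if "m \<in> points M'" for m
    using that sq a'(2) by simp
  {
    assume "admissible_mono M N f"
    moreover from this have "projective M" "projective N"
      unfolding admissible_mono_def by blast+
    ultimately have "admissible_mono M' N (f \<circ> \<alpha>')" "admissible_mono N N' \<beta>"
      using admissible_mono_comp admissible_mono_iso a'(1) b projective_iso by blast+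
    then have "admissible_mono M' N' (\<beta> \<circ> (f \<circ> \<alpha>'))" by (rule admissible_mono_comp)
    then show "admissible_mono M' N' f'" by (rule admissible_mono_cong[rotated]) (rule eq)
  next
    assume "admissible_epi M N f"
    moreover from this have "projective M" "projective N"
      unfolding admissible_epi_def by blast+
    ultimately have "admissible_epi M' N (f \<circ> \<alpha>')" "admissible_epi N N' \<beta>"
      using admissible_epi_comp admissible_epi_iso a a'(1) b projective_iso by blast+
    then have "admissible_epi M' N' (\<beta> \<circ> (f \<circ> \<alpha>'))" by (rule admissible_epi_comp)
    then show "admissible_epi M' N' f'" by (rule admissible_epi_cong[rotated]) (rule eq)
  }
qed

lemma admissible_square_iff:
  assumes a: "aset_iso M M' \<alpha>" and b: "aset_iso N N' \<beta>"
    and f: "aset_hom M N f" and f': "aset_hom M' N' f'"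
    and sq: "\<And>m. m \<in> points M \<Longrightarrow> \<beta> (f m) = f' (\<alpha> m)"
  shows "admissible_mono M N f \<longleftrightarrow> admissible_mono M' N' f'"
    and "admissible_epi M N f \<longleftrightarrow> admissible_epi M' N' f'"
proof -
  obtain \<alpha>' where a': "aset_iso M' M \<alpha>'" "\<forall>m\<in>points M'. \<alpha> (\<alpha>' m) = m"
    using aset_iso_inverse[OF a] by blast
  obtain \<beta>' where b': "aset_iso N' N \<beta>'" "\<forall>n\<in>points N. \<beta>' (\<beta> n) = n"
    using aset_iso_inverse[OF b] by blast
  \<comment> \<open>The square formed by the inverses also commutes, which gives the converse
    implications.\<close>
  have "\<beta>' (f' m) = f (\<alpha>' m)" if m: "m \<in> points M'" for m
  proof -
    have "\<alpha>' m \<in> points M" using a'(1) m unfolding aset_iso_def aset_hom_def by auto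
    moreover from this have "f (\<alpha>' m) \<in> points N" using f unfolding aset_hom_def by blast
    ultimately show ?thesis using sq a'(2) b'(2) m by metis
  qed
  then show "admissible_mono M N f \<longleftrightarrow> admissible_mono M' N' f'"
    and "admissible_epi M N f \<longleftrightarrow> admissible_epi M' N' f'"
    using admissible_square[OF a b f sq] admissible_square[OF a'(1) b'(1) f'] by blast+
qed

section \<open>Fiber products and base change\<close>

lemma fiber_product_simps:
  "x \<in> points (fiber_product K N f g) \<longleftrightarrow>
     fst x \<in> points K \<and> snd x \<in> points N \<and> f (fst x) = g (snd x)"
  "pt (fiber_product K N f g) = (pt K, pt N)"
  "act (fiber_product K N f g) a x = (act K a (fst x), act N a (snd x))"
  by (auto simp: fiber_product_def case_prod_beta)

lemma is_aset_fiber_product: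
  assumes "aset_hom K M f" "aset_hom N M g"
  shows "is_aset (fiber_product K N f g)"
  using assms unfolding aset_hom_def is_aset_def by (auto simp: fiber_product_simps)

lemma aset_hom_fiber_product:
  assumes "aset_hom K M f" "aset_hom N M g"
  shows "aset_hom (fiber_product K N f g) K fst" "aset_hom (fiber_product K N f g) N snd"
  using assms is_aset_fiber_product[OF assms] unfolding aset_hom_def
  by (simp_all add: fiber_product_simps)

text \<open>The factorization is the pairing of \<open>u\<close> and \<open>v\<close>, unique
  because a pair is determined by its coordinates.\<close>

lemma is_fiber_product_fiber_product:
  fixes K :: "('a::{monoid_mult, mult_zero}, 'k) aset" and N :: "('a, 'n) aset"
  assumes f: "aset_hom K M f" and g: "aset_hom N M g"
  shows "is_fiber_product TYPE('t) K M N f g (fiber_product K N f g) fst snd"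
  unfolding is_fiber_product_def
proof (intro conjI allI impI)
  fix T :: "('a, 't) aset" and u v
  assume *: "aset_hom T K u \<and> aset_hom T N v \<and> (\<forall>t\<in>points T. f (u t) = g (v t))"
  have "aset_hom T (fiber_product K N f g) (\<lambda>t. (u t, v t))"
    using * is_aset_fiber_product[OF f g] unfolding aset_hom_def
    by (auto simp: fiber_product_simps)
  then show "\<exists>h. aset_hom T (fiber_product K N f g) h \<and>
      (\<forall>t\<in>points T. fst (h t) = u t \<and> snd (h t) = v t) \<and>
      (\<forall>h'. aset_hom T (fiber_product K N f g) h' \<and>
         (\<forall>t\<in>points T. fst (h' t) = u t \<and> snd (h' t) = v t) \<longrightarrow> (\<forall>t\<in>points T. h' t = h t))"
    by (intro exI[of _ "\<lambda>t. (u t, v t)"]) (auto simp: prod_eq_iff)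
qed (use f g aset_hom_fiber_product[OF f g] in \<open>auto simp: fiber_product_simps\<close>)

text \<open>The projection \<open>snd\<close> is treated first: as an admissible monomorphism into
  the projective \<open>N\<close> it has a projective source, and this projectivity enters the
  criterion for \<open>fst\<close>.\<close>

lemma admissible_fiber_product:
  assumes f: "admissible_mono K M f" and g: "admissible_epi N M g"
  shows admissible_mono_snd: "admissible_mono (fiber_product K N f g) N snd"
    and admissible_epi_fst: "admissible_epi (fiber_product K N f g) K fst"
proof -
  let ?P = "fiber_product K N f g"
  have fh: "aset_hom K M f" and fi: "inj_on f (points K)"
    and fc: "\<And>a m. m \<in> points M \<Longrightarrow> m \<notin> f ` points K \<Longrightarrow> act M a m \<in> f ` points K \<Longrightarrow> act M a m = pt M"
    using f unfolding admissible_mono_iff by auto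
  have gh: "aset_hom N M g" and gi: "inj_on g (points N - aset_kernel N M g)" and N: "projective N"
    and gs: "g ` points N = points M"
    and gc: "\<And>a n. n \<in> points N \<Longrightarrow> g n \<noteq> pt M \<Longrightarrow> g (act N a n) = pt M \<Longrightarrow> act N a n = pt N"
    using g unfolding admissible_epi_iff normal_hom_def by auto
  have K: "projective K" using f unfolding admissible_mono_def by auto
  have ptK: "pt K \<in> points K" and fpt: "f (pt K) = pt M"
    and fK: "\<And>k. k \<in> points K \<Longrightarrow> f k \<in> points M"
    and fa: "\<And>a k. k \<in> points K \<Longrightarrow> f (act K a k) = act M a (f k)"
    using fh unfolding aset_hom_def is_aset_def by auto
  have f0: "k = pt K" if "k \<in> points K" "f k = pt M" for k
    using that fi ptK fpt by (metis inj_onD)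
  have gN: "\<And>n. n \<in> points N \<Longrightarrow> g n \<in> points M"
    and ga: "\<And>a n. n \<in> points N \<Longrightarrow> g (act N a n) = act M a (g n)"
    using gh unfolding aset_hom_def by auto
  note ph = aset_hom_fiber_product[OF fh gh]
  \<comment> \<open>This lets the complement condition for \<open>f\<close> be pulled back along
    \<open>g\<close> to the one for \<open>snd\<close>.\<close>
  have img: "n \<in> snd ` points ?P \<longleftrightarrow> n \<in> points N \<and> g n \<in> f ` points K" for n
  proof
    assume "n \<in> snd ` points ?P"
    then show "n \<in> points N \<and> g n \<in> f ` points K"
      by (auto simp: fiber_product_simps) (metis imageI)
  next
    assume "n \<in> points N \<and> g n \<in> f ` points K"
    then obtain k where "n \<in> points N" "k \<in> points K" "g n = f k" by auto
    then show "n \<in> snd ` points ?P"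
      by (intro image_eqI[of _ _ "(k, n)"]) (simp_all add: fiber_product_simps)
  qed
  \<comment> \<open>The second coordinate fixes \<open>f\<close> of the first, and \<open>f\<close>
    is injective.\<close>
  have "inj_on snd (points ?P)"
    using fi by (auto simp: inj_on_def fiber_product_simps)
  moreover have "act N a n = pt N"
    if n: "n \<in> points N" "n \<notin> snd ` points ?P" "act N a n \<in> snd ` points ?P" for a n
  proof -
    have gn: "g n \<notin> f ` points K" using n(1,2) img by blast
    have "act M a (g n) \<in> f ` points K" using n(1,3) img ga by metis
    \<comment> \<open>The condition for \<open>f\<close> gives the base point only in
      \<open>M\<close>. The condition for \<open>g\<close> lifts this to \<open>N\<close>; it
      applies because \<open>pt M\<close> lies in the image of \<open>f\<close> while
      \<open>g n\<close> does not.\<close>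
    then have "g (act N a n) = pt M" using fc[OF gN[OF n(1)] gn] ga[OF n(1)] by simp
    moreover have "g n \<noteq> pt M" using gn ptK fpt by (metis image_eqI)
    ultimately show ?thesis using gc n(1) by blast
  qed
  ultimately show snd: "admissible_mono ?P N snd"
    using N ph(2) unfolding admissible_mono_iff by blast
  then have P: "projective ?P" unfolding admissible_mono_def by blast
  have "fst ` points ?P = points K"
  proof
    show "points K \<subseteq> fst ` points ?P"
    proof
      fix k assume k: "k \<in> points K"
      then obtain n where "n \<in> points N" "f k = g n" using fK gs by (metis imageE)
      then show "k \<in> fst ` points ?P"
        using k by (intro image_eqI[of _ _ "(k, n)"]) (simp_all add: fiber_product_simps)
    qed
  qed (auto simp: fiber_product_simps)
  moreover have "inj_on fst (points ?P - aset_kernel ?P K fst)"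
  proof (rule inj_onI)
    fix x y
    assume "x \<in> points ?P - aset_kernel ?P K fst" "y \<in> points ?P - aset_kernel ?P K fst"
      and e: "fst x = fst y"
    then have x: "fst x \<in> points K" "snd x \<in> points N" "f (fst x) = g (snd x)" "fst x \<noteq> pt K"
      and y: "snd y \<in> points N" "f (fst y) = g (snd y)"
      by (auto simp: aset_kernel_def fiber_product_simps)
    \<comment> \<open>The trivial kernel of \<open>f\<close> places both second coordinates outside
      the kernel of \<open>g\<close>, where \<open>g\<close> is injective.\<close>
    have "g (snd x) \<noteq> pt M" using f0 x by metis
    moreover have "g (snd x) = g (snd y)" using e x y by simp
    ultimately have "snd x = snd y"
      using gi x(2) y(1) by (auto simp: inj_on_def aset_kernel_def)
    then show "x = y" using e by (simp add: prod_eq_iff)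
  qed
  moreover have "act ?P a x = pt ?P"
    if "x \<in> points ?P" "fst x \<noteq> pt K" "fst (act ?P a x) = pt K" for a x
  proof -
    have x: "fst x \<in> points K" "snd x \<in> points N" "f (fst x) = g (snd x)"
        and ax: "act K a (fst x) = pt K"
      using that by (simp_all add: fiber_product_simps)
    have "g (act N a (snd x)) = pt M" using ga[OF x(2)] fa[OF x(1)] x(3) ax fpt by metis
    moreover have "g (snd x) \<noteq> pt M" using f0 x(1,3) that(2) by metis
    ultimately show ?thesis using gc x(2) ax by (simp add: fiber_product_simps)
  qed
  ultimately show "admissible_epi ?P K fst"
    using P K ph(1) unfolding admissible_epi_iff normal_hom_def by blast
qed

text \<open>Existence of the fiber product is witnessed by the explicit \<open>A\<close>-set of
  compatible pairs. The type variable \<open>'t\<close> is arbitrary, so the universal property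
  holds for test objects over every type.\<close>

theorem proposition3p12:
  shows
  "(\<forall>(M :: ('a::{monoid_mult, mult_zero}, 'm) aset) (N :: ('a, 'n) aset)
      (M' :: ('a, 'm1) aset) (N' :: ('a, 'n1) aset) f f' \<alpha> \<beta>.
      in_Proj M \<and> in_Proj N \<and> in_Proj M' \<and> in_Proj N' \<and>
      aset_hom M N f \<and> aset_hom M' N' f' \<and> aset_iso M M' \<alpha> \<and> aset_iso N N' \<beta> \<and>
      (\<forall>m\<in>points M. \<beta> (f m) = f' (\<alpha> m)) \<longrightarrow>
        (admissible_mono M N f \<longleftrightarrow> admissible_mono M' N' f') \<and>
        (admissible_epi M N f \<longleftrightarrow> admissible_epi M' N' f'))
   \<and>
   (\<forall>(L :: ('a, 'l) aset) (M :: ('a, 'm) aset) (N :: ('a, 'n) aset) f g.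
      (admissible_mono L M f \<and> admissible_mono M N g \<longrightarrow> admissible_mono L N (g \<circ> f)) \<and>
      (admissible_epi L M f \<and> admissible_epi M N g \<longrightarrow> admissible_epi L N (g \<circ> f)))
   \<and>
   (\<forall>(K :: ('a, 'k) aset) (M :: ('a, 'm) aset) (N :: ('a, 'n) aset) f g.
      admissible_mono K M f \<and> admissible_epi N M g \<longrightarrow>
        is_fiber_product TYPE('t) K M N f g (fiber_product K N f g) fst snd \<and>
        projective (fiber_product K N f g) \<and>
        admissible_epi (fiber_product K N f g) K fst \<and>
        admissible_mono (fiber_product K N f g) N snd)"
proof (intro conjI allI impI; (elim conjE)?)
  fix M :: "('a, 'm) aset" and N :: "('a, 'n) aset" and M' :: "('a, 'm1) aset" and N' :: "('a, 'n1) aset"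
    and f f' \<alpha> \<beta>
  assume "aset_hom M N f" "aset_hom M' N' f'" "aset_iso M M' \<alpha>" "aset_iso N N' \<beta>"
    "\<forall>m\<in>points M. \<beta> (f m) = f' (\<alpha> m)"
  then show "admissible_mono M N f \<longleftrightarrow> admissible_mono M' N' f'"
    and "admissible_epi M N f \<longleftrightarrow> admissible_epi M' N' f'"
    by (auto simp: admissible_square_iff[of M M' \<alpha> N N' \<beta> f f'])
next
  fix K :: "('a, 'k) aset" and M :: "('a, 'm) aset" and N :: "('a, 'n) aset" and f g
  assume f: "admissible_mono K M f" and g: "admissible_epi N M g"
  have "aset_hom K M f" "aset_hom N M g"
    using f g unfolding admissible_mono_iff admissible_epi_iff normal_hom_def by auto
  then show "is_fiber_product TYPE('t) K M N f g (fiber_product K N f g) fst snd"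
    by (rule is_fiber_product_fiber_product)
  show "admissible_mono (fiber_product K N f g) N snd" by (rule admissible_mono_snd[OF f g])
  then show "projective (fiber_product K N f g)" unfolding admissible_mono_def by blast
  show "admissible_epi (fiber_product K N f g) K fst" by (rule admissible_epi_fst[OF f g])
qed (rule admissible_mono_comp admissible_epi_comp; assumption)+

end
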